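(* Let $\alpha\in\mathbb{R}\setminus\{0\}$, neglect damping ($\tau_{\mathrm{rel}}=+\infty$), assume periodic boundary conditions, and let the hyperbolic update satisfy the positivity assumption (P) and the conservation assumption (C) of the context. Let $[\rho_h^{n},\mathbf m_h^{n},\mathcal E_h^{n},\varphi_h^{n}]$ be a discrete state satisfying $\varrho_i^n>0$ and $\mathcal E_i^n-\frac{|\mathbf M_i^n|^2}{2\varrho_i^n}>0$ for all $i\in\mathcal V$, and let $[\rho_h^{n+1},\mathbf m_h^{n+1},\mathcal E_h^{n+1},\varphi_h^{n+1}]$ be the result of one step, of size $\tau_n>0$, of the first-order Yanenko splitting scheme defined in the context (hyperbolic update, producing the intermediate state with superscript $n+1,1$; then source update, producing the intermediate state with superscript $n+1,2$; then relaxation update). Then positivity of density and internal energy is preserved, i.e. $$\varrho_i^{n+1}>0,\qquad \mathcal E_i^{n+1}-\frac{|\mathbf M_i^{n+1}|^2}{2\varrho_i^{n+1}}>0\qquad\text{for all } i\in\mathcal V,$$ and the following energy balance holds: $$\sum_{i\in\mathcal V} m_i\,\mathcal E_i^{n+1}+\frac{1}{2\alpha}\|\nabla\varphi_h^{n+1}\|_{L^2(\Omega)}^2\;\le\;\sum_{i\in\mathcal V} m_i\,\mathcal E_i^{n}+\frac{1}{2\alpha}\|\nabla\varphi_h^{n}\|_{L^2(\Omega)}^2+\sum_{i\in\mathcal V} m_i\,\frac{\tau_n}{4}\big(\mathbf f_{a,i}^{n+1}+\mathbf f_{a,i}^{n}\big)\cdot\big(\mathbf V_i^{n+1,1}+\mathbf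 V_i^{n+1,2}\big),$$ where $\mathbf V_i^{n+1,k}=\mathbf M_i^{n+1,k}/\varrho_i^{n+1,k}$ for $k=1,2$.
   Context: **Spaces.** $\Omega\subset\mathbb{R}^d$ is a bounded domain with mesh $\mathcal T_h$; every element $K$ is the image of a reference element $\widehat K$ under a diffeomorphism $T_K$. One of two settings is used. Setting (S): $\widehat K$ is the unit simplex, all $T_K$ are affine, and $\widehat P=\mathbb P^1(\widehat K)$. Setting (Q): $\widehat K$ is the unit square/cube, and $\widehat P=\mathbb Q^1(\widehat K)$. Let $\mathbb H_h=\{\omega\in C^0(\Omega):\omega\circ T_K\in\widehat P\ \forall K\}$ (potential space; with periodic boundary conditions, its functions are periodic), $\mathbb V_h=\{z\in L^2(\Omega): z\circ T_K\in\widehat P\ \forall K\}$ (discontinuous), $\mathbf V_h=[\mathbb V_h]^d$. Let $\{\phi_i\}_{i\in\mathcal V}$ be the nodal Lagrange basis of $\mathbb V_h$ associated with the vertices of the elements (each $i\in\mathcal V$ belongs to exactly one element and has node $\mathbf x_i$), and $m_i=\int_\Omega\phi_i\,dx$. Functions $\rho_h,\mathcal E_h\in\mathbb V_h$, $\mathbf m_h\in\mathbf V_h$ have nodal coefficients $\varrho_i,\mathcal E_i\in\mathbb R$, $\mathbf M_i\in\mathbb R^d$. For functions $f,g$ that are continuous on each closed element (scalar- or vector-valued), the lumped product is $\langle f,g\rangle=\sum_{i\in\mathcal V} m_i\, f(\mathbf x_i)\cdot g(\mathbf x_i)$, where point values at $\mathbf x_i$ are taken from within the element to which $i$ belongs.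 $(\cdot,\cdot)$ is the $L^2(\Omega)$ inner product. $\mathbf f_a^{n},\mathbf f_a^{n+1}$ are given elementwise continuous vector fields (external force density) and $\mathbf f_{a,i}$ denotes the value at $\mathbf x_i$. **Bilinear forms.** Setting (S): $a^\pm_{\tau}(\varphi,\omega)=(\nabla\varphi,\nabla\omega)\pm\frac{\tau^2\alpha}{4}(\rho_h\nabla\varphi,\nabla\omega)$. Setting (Q): $a^\pm_{\tau}(\varphi,\omega)=(\nabla\varphi,\nabla\omega)\pm\frac{\tau^2\alpha}{4}\langle\rho_h\nabla\varphi,\nabla\omega\rangle$. Here $\rho_h$ is the density passed to the source update. **Hyperbolic update.** A map (with associated step size $\tau_n>0$) $\{\rho_h,\mathbf m_h,\mathcal E_h\}\mapsto\{\rho_h',\mathbf m_h',\mathcal E_h'\}$ for the compressible Euler equations, assumed to satisfy: (P) if $\varrho_i>0$ and $\mathcal E_i-\frac{|\mathbf M_i|^2}{2\varrho_i}>0$ for all $i$, then the same holds for the output; (C) with periodic or reflecting boundary conditions, $\sum_i m_i\mathcal E_i'=\sum_i m_i\mathcal E_i$. **Source update** with step $\tau$, from input $\{\rho_h,\mathbf m_h,\mathcal E_h,\varphi_h\}$ to output $\{\rho_h',\mathbf m_h',\mathcal E_h',\varphi_h'\}$: (1) set $\mathbf V_i=\mathbf M_i/\varrho_i$, $\mathbf v_h=\sum_i\mathbf V_i\phi_i$, and let $\varphi_h'\in\mathbb H_h$ be a solution of $a^+_\tau(\varphi_h',\omega)=a^-_\tau(\varphi_h,\omega)+\tau\alpha\langle\rho_h\mathbf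 v_h,\nabla\omega\rangle+\frac{\tau^2\alpha}{4}\langle\mathbf f_a^{n+1}+\mathbf f_a^{n},\nabla\omega\rangle$ for all $\omega\in\mathbb H_h$; (2) define $\mathbf V_i'$ by $\varrho_i\mathbf V_i'=\varrho_i\mathbf V_i-\frac{\tau}{2}\varrho_i(\nabla\varphi_h'+\nabla\varphi_h)(\mathbf x_i)+\frac{\tau}{2}(\mathbf f_{a,i}^{n+1}+\mathbf f_{a,i}^{n})$; (3) $\varrho_i'=\varrho_i$, $\mathbf M_i'=\varrho_i\mathbf V_i'$; (4) $\mathcal E_i'=\mathcal E_i+\frac{1}{2\varrho_i'}(|\mathbf M_i'|^2-|\mathbf M_i|^2)$. **Relaxation update** with step $\tau$ and relaxation time $\tau_{\mathrm{rel}}\in(0,\infty]$: $\mathbf M_i'=e^{-\tau/\tau_{\mathrm{rel}}}\mathbf M_i$ (identity if $\tau_{\mathrm{rel}}=\infty$), $\mathcal E_i'=\mathcal E_i+\frac{1}{2\varrho_i}(|\mathbf M_i'|^2-|\mathbf M_i|^2)$, $\varphi_h'=\varphi_h$, $\varrho_i'=\varrho_i$. **Yanenko splitting step.** (1) Apply the hyperbolic update to $\{\rho_h^n,\mathbf m_h^n,\mathcal E_h^n\}$, giving $\{\rho_h^{n+1,1},\mathbf m_h^{n+1,1},\mathcal E_h^{n+1,1}\}$ and $\tau_n$; set $\varphi_h^{n+1,1}=\varphi_h^n$. (2) Apply the source update with step $\tau_n$, giving the state with superscript $n+1,2$. (3) Apply the relaxation update with step $\tau_n$ and relaxation time $\tau_{\mathrm{rel}}$,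 giving the state with superscript $n+1$. *)

theory Defs
  imports "HOL-Analysis.Analysis"
begin

section \<open>Reference elements\<close>

text \<open>\<open>Simplicial\<close>: unit simplex with affine element maps and \<open>P\<^sup>1\<close>; \<open>Tensor\<close>: unit cube with
  general diffeomorphisms and \<open>Q\<^sup>1\<close>.\<close>

datatype setting = Simplicial | Tensor

fun ref_elem :: "setting \<Rightarrow> (real^'d) set" where
  "ref_elem Simplicial = convex hull (insert 0 Basis)"
| "ref_elem Tensor = cbox 0 1"

fun ref_vertices :: "setting \<Rightarrow> (real^'d) set" where
  "ref_vertices Simplicial = insert 0 Basis"
| "ref_vertices Tensor = {x. \<forall>j. x $ j = 0 \<or> x $ j = 1}"

text \<open>The polynomial spaces \<open>P\<^sup>1\<close> (affine functions) and \<open>Q\<^sup>1\<close> (degree at most one in each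
  variable: a combination of the monomials \<open>\<Prod>j\<in>A. x\<^sub>j\<close>), as functions on the whole space; they
  are compared with other functions on the reference element only.\<close>

fun ref_space :: "setting \<Rightarrow> (real^'d \<Rightarrow> real) set" where
  "ref_space Simplicial = {q. \<exists>c g. \<forall>x. q x = c + g \<bullet> x}"
| "ref_space Tensor = {q. \<exists>c :: 'd set \<Rightarrow> real. \<forall>x. q x = (\<Sum>A\<in>UNIV. c A * (\<Prod>j\<in>A. x $ j))}"


section \<open>Diffeomorphisms of closed sets\<close>

definition C1_on :: "'a::real_normed_vector set \<Rightarrow> ('a \<Rightarrow> 'b::real_normed_vector) \<Rightarrow> bool" where
  "C1_on A f \<longleftrightarrow> (\<exists>f' :: 'a \<Rightarrow> 'a \<Rightarrow>\<^sub>L 'b.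
     (\<forall>x\<in>A. (f has_derivative blinfun_apply (f' x)) (at x within A)) \<and> continuous_on A f')"

definition diffeomorphism :: "'a::real_normed_vector set \<Rightarrow> 'b::real_normed_vector set \<Rightarrow> ('a \<Rightarrow> 'b) \<Rightarrow> bool"
  where "diffeomorphism A B f \<longleftrightarrow> bij_betw f A B \<and> C1_on A f \<and> C1_on B (inv_into A f)"

definition affine_map_on :: "'a::real_vector set \<Rightarrow> ('a \<Rightarrow> 'b::real_vector) \<Rightarrow> bool" where
  "affine_map_on A f \<longleftrightarrow> (\<exists>L b. linear L \<and> (\<forall>x\<in>A. f x = L x + b))"


section \<open>Mesh and finite element spaces\<close>

text \<open>A function that is discontinuous across elements is given by its restrictions to the closed
  elements: \<open>f K x\<close>, for \<open>x \<in> K\<close>, is the value at \<open>x\<close> taken from within \<open>K\<close>.  Values for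
  \<open>x \<notin> K\<close> are irrelevant.\<close>

type_synonym ('d, 'b) broken = "(real^'d) set \<Rightarrow> real^'d \<Rightarrow> 'b"

text \<open>A degree of freedom is a pair of an element and one of its vertices.\<close>

type_synonym 'd node = "(real^'d) set \<times> (real^'d)"

text \<open>\<open>Tmap D K\<close> maps the reference element onto \<open>K \<in> Th D\<close>, and \<open>shape D i\<close> is the nodal basis
  function of \<open>i\<close>; \<open>mesh\<close>, \<open>nodal_basis\<close> and \<open>periodic_domain\<close> below state the requirements.\<close>

record ('d::finite) discretization =
  setting :: setting
  Omega :: "(real^'d) set"
  Th :: "(real^'d) set set"
  Tmap :: "(real^'d) set \<Rightarrow> real^'d \<Rightarrow> real^'d"
  periods :: "'d \<Rightarrow> real^'d"
  shape :: "'d node \<Rightarrow> ('d, real) broken"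

definition mesh :: "'d::finite discretization \<Rightarrow> bool" where
  "mesh D \<longleftrightarrow>
     open (Omega D) \<and> connected (Omega D) \<and> bounded (Omega D) \<and> Omega D \<noteq> {} \<and>
     finite (Th D) \<and> \<Union>(Th D) = closure (Omega D) \<and>
     (\<forall>K\<in>Th D. interior K \<subseteq> Omega D) \<and>
     (\<forall>K\<in>Th D. \<forall>K'\<in>Th D. K \<noteq> K' \<longrightarrow> interior K \<inter> interior K' = {}) \<and>
     (\<forall>K\<in>Th D. diffeomorphism (ref_elem (setting D)) K (Tmap D K)) \<and>
     (setting D = Simplicial \<longrightarrow> (\<forall>K\<in>Th D. affine_map_on (ref_elem Simplicial) (Tmap D K)))"

definition V_h :: "'d::finite discretization \<Rightarrow> ('d, real) broken set" where
  "V_h D = {z. \<forall>K\<in>Th D. \<exists>q\<in>ref_space (setting D). \<forall>x\<in>ref_elem (setting D). z K (Tmap D K x) = q x}"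

definition nodes :: "'d::finite discretization \<Rightarrow> 'd node set" where
  "nodes D = (SIGMA K:Th D. Tmap D K ` ref_vertices (setting D))"

definition at_node :: "('d, 'b) broken \<Rightarrow> 'd node \<Rightarrow> 'b" where
  "at_node f i = f (fst i) (snd i)"

definition nodal_basis :: "'d::finite discretization \<Rightarrow> bool" where
  "nodal_basis D \<longleftrightarrow>
     (\<forall>i\<in>nodes D. shape D i \<in> V_h D \<and>
        (\<forall>j\<in>nodes D. at_node (shape D i) j = (if i = j then 1 else 0)))"

text \<open>Periodic boundary conditions: the translates of the domain along the lattice generated by the
  linearly independent period vectors tile the space.  For a box these vectors are its edges.\<close>

definition period_lattice :: "'d::finite discretization \<Rightarrow> (real^'d) set" where
  "period_lattice D = {p. \<exists>c :: 'd \<Rightarrow> int. p = (\<Sum>j\<in>UNIV. of_int (c j) *\<^sub>R periods D j)}"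

definition periodic_domain :: "'d::finite discretization \<Rightarrow> bool" where
  "periodic_domain D \<longleftrightarrow>
     inj (periods D) \<and> independent (range (periods D)) \<and>
     (\<Union>p\<in>period_lattice D. (+) p ` closure (Omega D)) = UNIV \<and>
     (\<forall>p\<in>period_lattice D. p \<noteq> 0 \<longrightarrow> (+) p ` Omega D \<inter> Omega D = {})"

definition H_h :: "'d::finite discretization \<Rightarrow> (real^'d \<Rightarrow> real) set" where
  "H_h D = {w. continuous_on (Omega D) w \<and> (\<lambda>K. w) \<in> V_h D \<and>
     (\<forall>x\<in>closure (Omega D). \<forall>p\<in>period_lattice D. x + p \<in> closure (Omega D) \<longrightarrow> w (x + p) = w x)}"

definition elementwise_continuous ::
    "'d::finite discretization \<Rightarrow> ('d, 'b::topological_space) broken \<Rightarrow> bool" where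
  "elementwise_continuous D f \<longleftrightarrow> (\<forall>K\<in>Th D. continuous_on K (f K))"

definition fe_fun ::
    "'d::finite discretization \<Rightarrow> ('d node \<Rightarrow> 'b::real_vector) \<Rightarrow> ('d, 'b) broken" where
  "fe_fun D c = (\<lambda>K x. \<Sum>i\<in>nodes D. shape D i K x *\<^sub>R c i)"

text \<open>The gradient is taken within the closed element, hence is also defined at the vertices;
  in the interior it is the usual gradient.\<close>

definition grad :: "(real^'d \<Rightarrow> real) \<Rightarrow> ('d::finite, real^'d) broken" where
  "grad w = (\<lambda>K x. THE g. (w has_derivative (\<lambda>h. g \<bullet> h)) (at x within K))"


section \<open>Integrals, lumped product and bilinear forms\<close>

text \<open>The integral over the domain, which the elements partition up to a null set.\<close>

definition integral_Omega :: "'d::finite discretization \<Rightarrow> ('d, real) broken \<Rightarrow> real" where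
  "integral_Omega D f = (\<Sum>K\<in>Th D. LINT x:K|lborel. f K x)"

definition l2_prod ::
    "'d::finite discretization \<Rightarrow> ('d, 'b::real_inner) broken \<Rightarrow> ('d, 'b) broken \<Rightarrow> real" where
  "l2_prod D f g = integral_Omega D (\<lambda>K x. f K x \<bullet> g K x)"

definition l2_norm :: "'d::finite discretization \<Rightarrow> ('d, 'b::real_inner) broken \<Rightarrow> real" where
  "l2_norm D f = sqrt (l2_prod D f f)"

definition mass :: "'d::finite discretization \<Rightarrow> 'd node \<Rightarrow> real" where
  "mass D i = integral_Omega D (shape D i)"

definition lumped ::
    "'d::finite discretization \<Rightarrow> ('d, 'b::real_inner) broken \<Rightarrow> ('d, 'b) broken \<Rightarrow> real" where
  "lumped D f g = (\<Sum>i\<in>nodes D. mass D i * (at_node f i \<bullet> at_node g i))"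

definition weighted_form ::
    "'d::finite discretization \<Rightarrow> ('d node \<Rightarrow> real) \<Rightarrow> (real^'d \<Rightarrow> real) \<Rightarrow> (real^'d \<Rightarrow> real) \<Rightarrow> real" where
  "weighted_form D rho w v =
     (case setting D of
        Simplicial \<Rightarrow> l2_prod D (\<lambda>K x. fe_fun D rho K x *\<^sub>R grad w K x) (grad v)
      | Tensor \<Rightarrow> lumped D (\<lambda>K x. fe_fun D rho K x *\<^sub>R grad w K x) (grad v))"

definition a_plus ::
    "'d::finite discretization \<Rightarrow> real \<Rightarrow> real \<Rightarrow> ('d node \<Rightarrow> real) \<Rightarrow>
      (real^'d \<Rightarrow> real) \<Rightarrow> (real^'d \<Rightarrow> real) \<Rightarrow> real" where
  "a_plus D alpha tau rho w v =
     l2_prod D (grad w) (grad v) + tau\<^sup>2 * alpha / 4 * weighted_form D rho w v"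

definition a_minus ::
    "'d::finite discretization \<Rightarrow> real \<Rightarrow> real \<Rightarrow> ('d node \<Rightarrow> real) \<Rightarrow>
      (real^'d \<Rightarrow> real) \<Rightarrow> (real^'d \<Rightarrow> real) \<Rightarrow> real" where
  "a_minus D alpha tau rho w v =
     l2_prod D (grad w) (grad v) - tau\<^sup>2 * alpha / 4 * weighted_form D rho w v"


section \<open>The splitting scheme\<close>

text \<open>The fields are the nodal coefficients of density, momentum and total energy; only their values
  on \<open>nodes\<close> are meaningful.\<close>

record ('d::finite) euler =
  dens :: "'d node \<Rightarrow> real"
  mom :: "'d node \<Rightarrow> real^'d"
  ener :: "'d node \<Rightarrow> real"

definition velocity :: "'d::finite euler \<Rightarrow> 'd node \<Rightarrow> real^'d" where
  "velocity u i = mom u i /\<^sub>R dens u i"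

definition admissible :: "'d::finite discretization \<Rightarrow> 'd euler \<Rightarrow> bool" where
  "admissible D u \<longleftrightarrow>
     (\<forall>i\<in>nodes D. dens u i > 0 \<and> ener u i - (norm (mom u i))\<^sup>2 / (2 * dens u i) > 0)"

text \<open>A hyperbolic update maps a state to a step size and a new state.\<close>

type_synonym 'd hyperbolic = "'d euler \<Rightarrow> real \<times> 'd euler"

definition positivity_preserving :: "'d::finite discretization \<Rightarrow> 'd hyperbolic \<Rightarrow> bool" where
  "positivity_preserving D hyp \<longleftrightarrow> (\<forall>u. admissible D u \<longrightarrow> admissible D (snd (hyp u)))"

definition energy_conserving :: "'d::finite discretization \<Rightarrow> 'd hyperbolic \<Rightarrow> bool" where
  "energy_conserving D hyp \<longleftrightarrow>
     (\<forall>u. (\<Sum>i\<in>nodes D. mass D i * ener (snd (hyp u)) i) = (\<Sum>i\<in>nodes D. mass D i * ener u i))"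

text \<open>The source update is a relation, since the potential is only required to be some solution of
  the discrete equation.\<close>

definition source_update ::
    "'d::finite discretization \<Rightarrow> real \<Rightarrow> ('d, real^'d) broken \<Rightarrow> ('d, real^'d) broken \<Rightarrow> real \<Rightarrow>
      'd euler \<times> (real^'d \<Rightarrow> real) \<Rightarrow> 'd euler \<times> (real^'d \<Rightarrow> real) \<Rightarrow> bool" where
  "source_update D alpha f0 f1 tau = (\<lambda>(u, w) (u', w').
     w' \<in> H_h D \<and>
     (\<forall>v\<in>H_h D.
        a_plus D alpha tau (dens u) w' v =
          a_minus D alpha tau (dens u) w v
          + tau * alpha * lumped D (\<lambda>K x. fe_fun D (dens u) K x *\<^sub>R fe_fun D (velocity u) K x) (grad v)
          + tau\<^sup>2 * alpha / 4 * lumped D (\<lambda>K x. f1 K x + f0 K x) (grad v)) \<and>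
     (\<exists>V'. \<forall>i\<in>nodes D.
        dens u i *\<^sub>R V' i =
          dens u i *\<^sub>R velocity u i
          - (tau / 2 * dens u i) *\<^sub>R (at_node (grad w') i + at_node (grad w) i)
          + (tau / 2) *\<^sub>R (at_node f1 i + at_node f0 i) \<and>
        dens u' i = dens u i \<and>
        mom u' i = dens u i *\<^sub>R V' i \<and>
        ener u' i = ener u i + 1 / (2 * dens u' i) * ((norm (mom u' i))\<^sup>2 - (norm (mom u i))\<^sup>2)))"

definition damping :: "real \<Rightarrow> ereal \<Rightarrow> real" where
  "damping tau tau_rel = (if tau_rel = \<infinity> then 1 else exp (- tau / real_of_ereal tau_rel))"

definition relaxation_update ::
    "'d::finite discretization \<Rightarrow> ereal \<Rightarrow> real \<Rightarrow>
      'd euler \<times> (real^'d \<Rightarrow> real) \<Rightarrow> 'd euler \<times> (real^'d \<Rightarrow> real) \<Rightarrow> bool" where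
  "relaxation_update D tau_rel tau = (\<lambda>(u, w) (u', w').
     0 < tau_rel \<and> w' = w \<and>
     (\<forall>i\<in>nodes D.
        dens u' i = dens u i \<and>
        mom u' i = damping tau tau_rel *\<^sub>R mom u i \<and>
        ener u' i = ener u i + 1 / (2 * dens u i) * ((norm (mom u' i))\<^sup>2 - (norm (mom u i))\<^sup>2)))"

definition yanenko_step ::
    "'d::finite discretization \<Rightarrow> 'd hyperbolic \<Rightarrow> real \<Rightarrow> ereal \<Rightarrow>
      ('d, real^'d) broken \<Rightarrow> ('d, real^'d) broken \<Rightarrow> real \<Rightarrow>
      'd euler \<times> (real^'d \<Rightarrow> real) \<Rightarrow> 'd euler \<times> (real^'d \<Rightarrow> real) \<Rightarrow>
      'd euler \<times> (real^'d \<Rightarrow> real) \<Rightarrow> 'd euler \<times> (real^'d \<Rightarrow> real) \<Rightarrow> bool" where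
  "yanenko_step D hyp alpha tau_rel f0 f1 tau s0 s1 s2 s' \<longleftrightarrow>
     hyp (fst s0) = (tau, fst s1) \<and> snd s1 = snd s0 \<and>
     source_update D alpha f0 f1 tau s1 s2 \<and>
     relaxation_update D tau_rel tau s2 s'"

end

theory Submission
  imports Defs
begin

text \<open>Testing the potential equation with the sum \<open>v\<close> of the new and the old potential gives the
  increment of \<open>\<parallel>\<nabla>\<phi>\<parallel>\<^sup>2\<close>; pairing the velocity update at each node with the sum of the velocities
  gives the increment of the kinetic energy. In the combination the lumped terms in \<open>\<nabla>v\<close> cancel up
  to a multiple of the difference between \<open>\<Sum>\<^sub>i m\<^sub>i \<rho>\<^sub>i |\<nabla>v(x\<^sub>i)|\<^sup>2\<close> and the weighted form at \<open>(v, v)\<close>.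
  This difference vanishes: by definition in the tensor setting, and in the simplicial one because
  gradients are constant on elements, so that the integral of \<open>\<rho>\<^sub>h\<close> over an element is the sum of
  \<open>m\<^sub>i \<rho>\<^sub>i\<close> over its vertices. The energy balance is therefore an equality. The hyperbolic and relaxation updates do
  not change the total energy, and the source update does not change the internal energy.\<close>

section \<open>Uniqueness of derivatives within elements, up to the boundary\<close>

text \<open>The library's \<open>frechet_derivative_unique_within\<close> needs points of \<open>S\<close> in every coordinate
  direction from \<open>x\<close>; these are missing at the vertices of the unit simplex.\<close>

lemma has_derivative_unique_within_convex:
  fixes f :: "'a::real_normed_vector \<Rightarrow> 'b::real_normed_vector"
  assumes F: "(f has_derivative F) (at x within S)" and G: "(f has_derivative G) (at x within S)"
    and S: "convex S" "interior S \<noteq> {}" and x: "x \<in> S"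
  shows "F = G"
proof -
  have lin: "linear F" "linear G"
    using F G by (auto intro: has_derivative_linear)
  \<comment> \<open>Restricting \<open>f\<close> to the segment from \<open>x\<close> to
    \<open>z\<close>, which convexity keeps inside \<open>S\<close>, reduces the claim in direction
    \<open>z - x\<close> to one variable; on a closed interval derivatives are unique even at the
    endpoint 0.\<close>
  have along: "(f \<circ> (\<lambda>t. x + t *\<^sub>R (z - x)) has_vector_derivative L (z - x)) (at 0 within cbox 0 1)"
    if L: "(f has_derivative L) (at x within S)" and z: "z \<in> S" for L z
  proof -
    have sub: "(\<lambda>t. x + t *\<^sub>R (z - x)) ` cbox 0 1 \<subseteq> S"
    proof clarify
      fix t :: real
      assume "t \<in> cbox 0 1"
      then have "(1 - t) *\<^sub>R x + t *\<^sub>R z \<in> S"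
        using S x z by (intro convexD) auto
      then show "x + t *\<^sub>R (z - x) \<in> S"
        by (simp add: algebra_simps)
    qed
    have "((\<lambda>t. x + t *\<^sub>R (z - x)) has_derivative (\<lambda>t. t *\<^sub>R (z - x))) (at 0 within cbox 0 1)"
      by (auto intro!: derivative_eq_intros)
    moreover have "(f has_derivative L) (at (x + 0 *\<^sub>R (z - x)) within (\<lambda>t. x + t *\<^sub>R (z - x)) ` cbox 0 1)"
      using has_derivative_subset[OF L sub] by simp
    ultimately have "((\<lambda>t. f (x + t *\<^sub>R (z - x))) has_derivative (\<lambda>t. L (t *\<^sub>R (z - x)))) (at 0 within cbox 0 1)"
      by (rule has_derivative_in_compose)
    then show ?thesis
      using has_derivative_linear[OF L] by (simp add: has_vector_derivative_def o_def linear_scale)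
  qed
  have eq: "F (z - x) = G (z - x)" if "z \<in> S" for z
    using vector_derivative_unique_within_closed_interval[OF _ _ along[OF F that] along[OF G that]]
    by simp
  \<comment> \<open>Only directions pointing from \<open>x\<close> into \<open>S\<close> are covered
    so far. Differences of two of them give every small vector, since \<open>S\<close> contains a
    ball, and scaling then gives all vectors.\<close>
  obtain c e where e: "e > 0" "ball c e \<subseteq> S"
    using S(2) by (metis ex_in_conv mem_interior)
  have "F h = G h" for h
  proof -
    \<comment> \<open>Small enough for \<open>c + t *\<^sub>R h\<close> to stay in the ball; the
      \<open>+ 1\<close> keeps the denominator positive for \<open>h = 0\<close>.\<close>
    define t where "t = e / (2 * (norm h + 1))"
    have t: "t > 0"
      using e by (auto simp: t_def intro!: divide_pos_pos add_nonneg_pos)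
    have "t * norm h < e"
      using e by (simp add: t_def divide_simps add_nonneg_pos)
    then have "c + t *\<^sub>R h \<in> S" "c \<in> S"
      using e t by (auto simp: dist_norm subset_iff)
    then have "F (c + t *\<^sub>R h - x) - F (c - x) = G (c + t *\<^sub>R h - x) - G (c - x)"
      using eq by simp
    then have "F (t *\<^sub>R h) = G (t *\<^sub>R h)"
      by (simp add: linear_diff[OF lin(1), symmetric] linear_diff[OF lin(2), symmetric])
    then show ?thesis
      using t lin by (simp add: linear_scale)
  qed
  then show ?thesis by blast
qed

lemma C1_on_imp_continuous_on: "C1_on A f \<Longrightarrow> continuous_on A f"
  unfolding C1_on_def by (meson has_derivative_continuous_on)

text \<open>Differentiating \<open>inv_into R T (T x) = x\<close> shows that \<open>T'\<close> has a
  left inverse. It is therefore injective, and surjective because source and target have the same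
  finite dimension.\<close>

lemma diffeomorphism_derivative:
  fixes T :: "'a::euclidean_space \<Rightarrow> 'a"
  assumes T: "diffeomorphism R K T" and R: "convex R" "interior R \<noteq> {}" and y: "y \<in> R"
  obtains T' where "(T has_derivative T') (at y within R)" "linear T'" "surj T'"
proof -
  from T obtain T' S' where T': "(T has_derivative T') (at y within R)"
    and S': "(inv_into R T has_derivative S') (at (T y) within K)"
    using y unfolding diffeomorphism_def C1_on_def bij_betw_def by blast
  have inj: "inj_on T R" and K: "K = T ` R"
    using T by (auto simp: diffeomorphism_def bij_betw_def)
  have "((\<lambda>x. inv_into R T (T x)) has_derivative (\<lambda>h. S' (T' h))) (at y within R)"
    using S' unfolding K by (rule has_derivative_in_compose[OF T'])
  then have "((\<lambda>x. x) has_derivative (\<lambda>h. S' (T' h))) (at y within R)"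
    by (rule has_derivative_transform[OF y, rotated]) (simp add: inj)
  then have "(\<lambda>h. S' (T' h)) = (\<lambda>h. h)"
    using has_derivative_ident R y by (rule has_derivative_unique_within_convex)
  then have "inj T'"
    by (metis injI)
  moreover have "linear T'"
    using T' by (rule has_derivative_linear)
  ultimately show ?thesis
    using that T' linear_injective_imp_surjective by blast
qed

text \<open>The element \<open>K\<close> itself may fail to be convex, so both derivatives are
  pulled back to \<open>R\<close> by the chain rule. They then agree on the range of
  \<open>T'\<close>, which is the whole space.\<close>

lemma has_derivative_unique_within_diffeomorphic:
  fixes T :: "'a::euclidean_space \<Rightarrow> 'a" and f :: "'a \<Rightarrow> 'b::real_normed_vector"
  assumes T: "diffeomorphism R K T" and R: "convex R" "interior R \<noteq> {}" and x: "x \<in> K"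
    and F: "(f has_derivative F) (at x within K)" and G: "(f has_derivative G) (at x within K)"
  shows "F = G"
proof -
  have K: "K = T ` R"
    using T by (auto simp: diffeomorphism_def bij_betw_def)
  with x obtain y where y: "y \<in> R" "x = T y" by blast
  obtain T' where T': "(T has_derivative T') (at y within R)" "surj T'"
    using diffeomorphism_derivative[OF T R y(1)] by metis
  have "(\<lambda>h. F (T' h)) = (\<lambda>h. G (T' h))"
    using has_derivative_in_compose[OF T'(1) F[unfolded K y(2)]]
      has_derivative_in_compose[OF T'(1) G[unfolded K y(2)]] R y(1)
    by (rule has_derivative_unique_within_convex)
  then show ?thesis
    using T'(2) by (metis ext surj_f_inv_f)
qed

section \<open>Reference elements and their polynomial spaces\<close>

lemma convex_ref_elem: "convex (ref_elem s)"
  by (cases s) auto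

lemma compact_ref_elem: "compact (ref_elem s)"
  by (cases s) (auto intro: finite_imp_compact_convex_hull)

lemma interior_ref_elem: "interior (ref_elem s) \<noteq> {}"
proof (cases s)
  case Simplicial
  then show ?thesis
    using interior_std_simplex_nonempty by (metis empty_iff ref_elem.simps(1))
next
  case Tensor
  then show ?thesis
    by (simp add: interval_ne_empty_cart)
qed

lemma ref_vertices_subset: "ref_vertices s \<subseteq> ref_elem s"
proof (cases s)
  case Simplicial
  then show ?thesis
    using hull_subset[of "insert 0 Basis" convex] by simp
next
  case Tensor
  then show ?thesis
    by (auto simp: mem_box_cart) (metis order_refl zero_le_one)+
qed

lemma finite_ref_vertices: "finite (ref_vertices s :: (real^'d) set)"
proof (cases s)
  case Tensor
  \<comment> \<open>A 0-1 vector is encoded by the set of its coordinates equal to 1.\<close>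
  have "ref_vertices s \<subseteq> range (\<lambda>A::'d set. \<chi> j. if j \<in> A then 1 else 0)"
  proof
    fix x :: "real^'d"
    assume "x \<in> ref_vertices s"
    then have "x = (\<chi> j. if j \<in> {j. x $ j = 1} then 1 else 0)"
      using Tensor by (auto simp: vec_eq_iff)
    then show "x \<in> range (\<lambda>A::'d set. \<chi> j. if j \<in> A then 1 else 0)"
      by blast
  qed
  then show ?thesis
    by (rule finite_subset) simp
qed simp

lemma ref_space_add:
  assumes "p \<in> ref_space s" "q \<in> ref_space s"
  shows "(\<lambda>x. p x + q x) \<in> ref_space s"
proof (cases s)
  case Simplicial
  with assms obtain a b g h where "\<And>x. p x = a + g \<bullet> x" "\<And>x. q x = b + h \<bullet> x"
    by auto
  then have "p x + q x = (a + b) + (g + h) \<bullet> x" for x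
    by (simp add: inner_add_left)
  then show ?thesis
    unfolding Simplicial by simp blast
next
  case Tensor
  with assms obtain a b where "\<And>x. p x = (\<Sum>A\<in>UNIV. a A * (\<Prod>j\<in>A. x $ j))"
    "\<And>x. q x = (\<Sum>A\<in>UNIV. b A * (\<Prod>j\<in>A. x $ j))"
    by auto
  then have "p x + q x = (\<Sum>A\<in>UNIV. (a A + b A) * (\<Prod>j\<in>A. x $ j))" for x
    by (simp add: sum.distrib distrib_right)
  then show ?thesis
    unfolding Tensor by simp (rule exI[of _ "\<lambda>A. a A + b A"], simp)
qed

text \<open>The inner product form matches the definition of \<open>grad\<close>; continuity of
  \<open>G\<close> is what later makes products of gradients integrable.\<close>

lemma ref_space_gradient:
  assumes "q \<in> ref_space s"
  obtains G where "continuous_on UNIV G" "\<And>x. (q has_derivative (\<lambda>h. G x \<bullet> h)) (at x)"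
proof (cases s)
  case Simplicial
  with assms obtain c g where q: "q = (\<lambda>x. c + g \<bullet> x)"
    by auto
  show ?thesis
    by (rule that[of "\<lambda>_. g"]) (auto simp: q intro!: derivative_eq_intros)
next
  case Tensor
  with assms obtain c :: "'a set \<Rightarrow> real" where q: "q = (\<lambda>x. \<Sum>A\<in>UNIV. c A * (\<Prod>j\<in>A. x $ j))"
    by auto
  define G where "G x = (\<Sum>A\<in>UNIV. \<Sum>i\<in>A.
      (c A * (\<Prod>j\<in>A - {i}. x $ j)) *\<^sub>R axis i (1::real))" for x :: "real^'a"
  have coord: "((\<lambda>x::real^'a. x $ i) has_derivative (\<lambda>h. h $ i)) (at x)" for i x
    by (simp add: bounded_linear_imp_has_derivative bounded_linear_vec_nth)
  have "(q has_derivative (\<lambda>h. \<Sum>A\<in>UNIV. c A * (\<Sum>i\<in>A. h $ i * (\<Prod>j\<in>A - {i}. x $ j)))) (at x)" for x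
    unfolding q by (intro has_derivative_sum has_derivative_mult_right has_derivative_prod coord)
  moreover have "(\<Sum>A\<in>UNIV. c A * (\<Sum>i\<in>A. h $ i * (\<Prod>j\<in>A - {i}. x $ j))) = G x \<bullet> h" for x h
    by (simp add: G_def inner_sum_left inner_axis' sum_distrib_left mult_ac)
  moreover have "continuous_on UNIV G"
    unfolding G_def by (intro continuous_intros)
  ultimately show ?thesis
    using that by simp
qed

text \<open>Unisolvence of the affine functions: the value at the origin fixes the constant, and the
  values at the basis vectors then fix the slope.\<close>

lemma ref_space_Simplicial_zero:
  assumes q: "q \<in> ref_space Simplicial" and z: "\<And>x. x \<in> ref_vertices Simplicial \<Longrightarrow> q x = 0"
  shows "q x = 0"
proof -
  obtain c g where cg: "\<And>x. q x = c + g \<bullet> x"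
    using q by auto
  have "c = 0"
    using z[of 0] cg by simp
  then have "g \<bullet> b = 0" if "b \<in> Basis" for b
    using z[of b] cg that by simp
  then have "g = 0"
    using euclidean_all_zero_iff by blast
  with \<open>c = 0\<close> cg show ?thesis by simp
qed

section \<open>Elements, and gradients of finite element functions\<close>

lemma meshD:
  assumes "mesh D" "K \<in> Th D"
  shows "diffeomorphism (ref_elem (setting D)) K (Tmap D K)"
    and "K = Tmap D K ` ref_elem (setting D)"
  using assms by (auto simp: mesh_def diffeomorphism_def bij_betw_def)

lemma compact_element: "mesh D \<Longrightarrow> K \<in> Th D \<Longrightarrow> compact K"
  using meshD[of D K] compact_continuous_image[of "ref_elem (setting D)" "Tmap D K"]
  by (simp add: diffeomorphism_def C1_on_imp_continuous_on compact_ref_elem)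

lemma finite_nodes: "mesh D \<Longrightarrow> finite (nodes D)"
  by (auto simp: nodes_def mesh_def finite_ref_vertices)

lemma node_in_element: "mesh D \<Longrightarrow> i \<in> nodes D \<Longrightarrow> fst i \<in> Th D \<and> snd i \<in> fst i"
  using meshD(2)[of D "fst i"] ref_vertices_subset[of "setting D"] unfolding nodes_def by fastforce

text \<open>On \<open>K\<close> the function is a polynomial composed with the inverse element map.
  That inverse is continuously differentiable on the closed element, so the chain rule works up to
  the boundary.\<close>

lemma V_h_has_derivative:
  assumes D: "mesh D" "K \<in> Th D" and z: "z \<in> V_h D"
  obtains g where "continuous_on K g"
    "\<And>x. x \<in> K \<Longrightarrow> (z K has_derivative (\<lambda>h. g x \<bullet> h)) (at x within K)"
proof -
  let ?R = "ref_elem (setting D)" and ?T = "Tmap D K"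
  let ?S = "inv_into ?R ?T"
  obtain q where q: "q \<in> ref_space (setting D)" "\<And>x. x \<in> ?R \<Longrightarrow> z K (?T x) = q x"
    using z D by (auto simp: V_h_def)
  obtain G where G: "continuous_on UNIV G" "\<And>x. (q has_derivative (\<lambda>h. G x \<bullet> h)) (at x)"
    using ref_space_gradient[OF q(1)] by metis
  have "C1_on K ?S"
    using meshD(1)[OF D] by (simp add: diffeomorphism_def)
  then obtain S' where S': "continuous_on K S'"
    "\<And>x. x \<in> K \<Longrightarrow> (?S has_derivative blinfun_apply (S' x)) (at x within K)"
    unfolding C1_on_def by blast
  \<comment> \<open>The transpose of \<open>S' x\<close> applied to \<open>G (?S x)\<close>, written
    in coordinates so that its continuity can be read off.\<close>
  define g where "g x = (\<Sum>b\<in>Basis. (G (?S x) \<bullet> blinfun_apply (S' x) b) *\<^sub>R b)" for x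
  have g: "g x \<bullet> h = G (?S x) \<bullet> blinfun_apply (S' x) h" for x h
  proof -
    have "blinfun_apply (S' x) h = (\<Sum>b\<in>Basis. (h \<bullet> b) *\<^sub>R blinfun_apply (S' x) b)"
      by (subst euclidean_representation[of h, symmetric]) (simp only: blinfun.sum_right blinfun.scaleR_right)
    then show ?thesis
      by (simp add: g_def inner_sum_left inner_sum_right inner_commute mult.commute)
  qed
  have contS: "continuous_on K ?S"
    using \<open>C1_on K ?S\<close> by (rule C1_on_imp_continuous_on)
  have "continuous_on K (\<lambda>x. G (?S x))"
    using continuous_on_compose2[OF G(1) contS] by simp
  then have "continuous_on K g"
    unfolding g_def by (intro continuous_intros S'(1))
  moreover have "(z K has_derivative (\<lambda>h. g x \<bullet> h)) (at x within K)" if x: "x \<in> K" for x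
  proof -
    have "((\<lambda>x. q (?S x)) has_derivative (\<lambda>h. G (?S x) \<bullet> blinfun_apply (S' x) h)) (at x within K)"
      by (rule has_derivative_in_compose[OF S'(2)[OF x]]) (rule has_derivative_at_withinI[OF G(2)])
    moreover have "z K x = q (?S x)" if "x \<in> K" for x
      using that q(2)[of "?S x"] meshD(2)[OF D] by (metis f_inv_into_f inv_into_into)
    ultimately show ?thesis
      unfolding g by (rule has_derivative_transform[OF x, rotated])
  qed
  ultimately show ?thesis
    using that by blast
qed

text \<open>Uniqueness gives the definite description in \<open>grad\<close> its meaning, also at
  the vertices, where the scheme evaluates gradients.\<close>

lemma grad_eqI:
  assumes D: "mesh D" "K \<in> Th D" and x: "x \<in> K"
    and w: "(w has_derivative (\<lambda>h. g \<bullet> h)) (at x within K)"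
  shows "grad w K x = g"
  unfolding grad_def
proof (rule the_equality)
  show "(w has_derivative (\<lambda>h. g \<bullet> h)) (at x within K)"
    by (rule w)
next
  fix g' assume "(w has_derivative (\<lambda>h. g' \<bullet> h)) (at x within K)"
  then have "(\<lambda>h. g' \<bullet> h) = (\<lambda>h. g \<bullet> h)"
    using has_derivative_unique_within_diffeomorphic[OF meshD(1)[OF D] convex_ref_elem interior_ref_elem x] w
    by blast
  then show "g' = g"
    by (metis inner_commute vector_eq_rdot)
qed

lemma H_h_gradient:
  assumes D: "mesh D" "K \<in> Th D" and w: "w \<in> H_h D"
  shows "continuous_on K (grad w K)"
    and "x \<in> K \<Longrightarrow> (w has_derivative (\<lambda>h. grad w K x \<bullet> h)) (at x within K)"
proof -
  obtain g where g: "continuous_on K g"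
    "\<And>x. x \<in> K \<Longrightarrow> (w has_derivative (\<lambda>h. g x \<bullet> h)) (at x within K)"
    using V_h_has_derivative[OF D, of "\<lambda>_. w"] w by (auto simp: H_h_def)
  then have eq: "grad w K x = g x" if "x \<in> K" for x
    using grad_eqI[OF D that] that by blast
  then show "continuous_on K (grad w K)"
    using g(1) continuous_on_eq by metis
  show "x \<in> K \<Longrightarrow> (w has_derivative (\<lambda>h. grad w K x \<bullet> h)) (at x within K)"
    using g(2) eq by simp
qed

lemma grad_add:
  assumes D: "mesh D" "K \<in> Th D" and w: "w \<in> H_h D" "v \<in> H_h D" and x: "x \<in> K"
  shows "grad (\<lambda>x. w x + v x) K x = grad w K x + grad v K x"
  using has_derivative_add[OF H_h_gradient(2)[OF D w(1) x] H_h_gradient(2)[OF D w(2) x]]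
  by (intro grad_eqI[OF D x]) (simp add: inner_add_left)

text \<open>This makes the sum of the old and the new potential an admissible test function.\<close>

lemma H_h_add:
  assumes "w \<in> H_h D" "v \<in> H_h D"
  shows "(\<lambda>x. w x + v x) \<in> H_h D"
  unfolding H_h_def
proof (intro CollectI conjI)
  show "continuous_on (Omega D) (\<lambda>x. w x + v x)"
    using assms by (auto simp: H_h_def intro: continuous_on_add)
  show "(\<lambda>K x. w x + v x) \<in> V_h D"
    unfolding V_h_def
  proof (intro CollectI ballI)
    fix K assume "K \<in> Th D"
    then obtain p q where "p \<in> ref_space (setting D)" "q \<in> ref_space (setting D)"
      "\<forall>x\<in>ref_elem (setting D). w (Tmap D K x) = p x" "\<forall>x\<in>ref_elem (setting D). v (Tmap D K x) = q x"
      using assms unfolding H_h_def V_h_def by blast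
    then show "\<exists>q\<in>ref_space (setting D). \<forall>x\<in>ref_elem (setting D). w (Tmap D K x) + v (Tmap D K x) = q x"
      using ref_space_add by (intro bexI[of _ "\<lambda>x. p x + q x"]) auto
  qed
  show "\<forall>x\<in>closure (Omega D). \<forall>p\<in>period_lattice D. x + p \<in> closure (Omega D) \<longrightarrow>
      w (x + p) + v (x + p) = w x + v x"
    using assms by (simp add: H_h_def)
qed

section \<open>Integrals over the mesh and the gradient product\<close>

lemma set_integrable_element:
  fixes f :: "real^'d \<Rightarrow> real"
  assumes "mesh D" "K \<in> Th D" "continuous_on K f"
  shows "set_integrable lborel K f"
  unfolding set_integrable_def using assms by (intro borel_integrable_compact compact_element)

lemma integral_Omega_add:
  assumes "mesh D" "\<And>K. K \<in> Th D \<Longrightarrow> continuous_on K (f K)" "\<And>K. K \<in> Th D \<Longrightarrow> continuous_on K (g K)"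
  shows "integral_Omega D (\<lambda>K x. f K x + g K x) = integral_Omega D f + integral_Omega D g"
  unfolding integral_Omega_def sum.distrib[symmetric]
  using assms by (intro sum.cong refl set_integral_add(2) set_integrable_element)

lemma set_integral_cong_pointwise:
  fixes f g :: "'a \<Rightarrow> 'b::{banach, second_countable_topology}"
  assumes "\<And>x. x \<in> A \<Longrightarrow> f x = g x"
  shows "(LINT x:A|M. f x) = (LINT x:A|M. g x)"
  unfolding set_lebesgue_integral_def
  by (rule Bochner_Integration.integral_cong) (auto simp: assms split: split_indicator)

text \<open>A difference of squares: the mixed products cancel by symmetry. Splitting the integrals
  needs integrability, which comes from continuity of the gradients on the compact elements.\<close>

lemma l2_prod_grad_sum_diff:
  assumes D: "mesh D" and w: "w \<in> H_h D" "v \<in> H_h D"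
  shows "l2_prod D (grad w) (grad (\<lambda>x. w x + v x)) - l2_prod D (grad v) (grad (\<lambda>x. w x + v x))
    = l2_prod D (grad w) (grad w) - l2_prod D (grad v) (grad v)"
proof -
  have expand: "l2_prod D (grad u) (grad (\<lambda>x. w x + v x)) = l2_prod D (grad u) (grad w) + l2_prod D (grad u) (grad v)"
    if u: "u \<in> H_h D" for u
  proof -
    have "l2_prod D (grad u) (grad (\<lambda>x. w x + v x))
      = integral_Omega D (\<lambda>K x. grad u K x \<bullet> grad w K x + grad u K x \<bullet> grad v K x)"
      unfolding l2_prod_def integral_Omega_def
      by (intro sum.cong refl set_integral_cong_pointwise)
        (simp_all add: grad_add[OF D _ w] inner_add_right)
    also have "\<dots> = l2_prod D (grad u) (grad w) + l2_prod D (grad u) (grad v)"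
      unfolding l2_prod_def
      by (intro integral_Omega_add D continuous_intros H_h_gradient(1)[OF D] u w)
    finally show ?thesis .
  qed
  have "l2_prod D (grad w) (grad v) = l2_prod D (grad v) (grad w)"
    by (simp add: l2_prod_def inner_commute)
  then show ?thesis
    by (simp add: expand w)
qed

lemma l2_norm_power2: "(l2_norm D f)\<^sup>2 = l2_prod D f f"
proof -
  have "0 \<le> l2_prod D f f"
    by (auto simp: l2_prod_def integral_Omega_def set_lebesgue_integral_def intro!: sum_nonneg Bochner_Integration.integral_nonneg)
  then show ?thesis
    by (simp add: l2_norm_def)
qed

section \<open>Nodal values and exactness of the lumped weighted form\<close>

lemma at_node_fe_fun:
  assumes "mesh D" "nodal_basis D" "j \<in> nodes D"
  shows "at_node (fe_fun D c) j = c j"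
proof -
  have "at_node (fe_fun D c) j = (\<Sum>i\<in>nodes D. at_node (shape D i) j *\<^sub>R c i)"
    by (simp add: at_node_def fe_fun_def)
  also have "\<dots> = (\<Sum>i\<in>nodes D. if i = j then c i else 0)"
    using assms by (intro sum.cong) (auto simp: nodal_basis_def)
  also have "\<dots> = c j"
    using assms(3) finite_nodes[OF assms(1)] by (simp add: sum.delta)
  finally show ?thesis .
qed

text \<open>Pulling back along the affine map with linear part \<open>L\<close> gives
  \<open>grad w K x \<bullet> L h = g \<bullet> h\<close>, where \<open>L\<close> and the slope
  \<open>g\<close> do not depend on the point. As \<open>L\<close> is onto, this determines the
  gradient.\<close>

lemma grad_const_Simplicial:
  assumes D: "mesh D" "K \<in> Th D" and s: "setting D = Simplicial"
    and w: "w \<in> H_h D" and x: "x \<in> K" "x' \<in> K"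
  shows "grad w K x = grad w K x'"
proof -
  let ?R = "ref_elem Simplicial :: (real^'a) set" and ?T = "Tmap D K"
  obtain L b where L: "linear L" "\<And>y. y \<in> ?R \<Longrightarrow> ?T y = L y + b"
    using D s unfolding mesh_def affine_map_on_def by metis
  obtain q where q: "q \<in> ref_space (setting D)" "\<forall>x\<in>?R. w (?T x) = q x"
    using w D s unfolding H_h_def V_h_def by (auto simp del: ref_elem.simps ref_space.simps)
  then obtain c g where cg: "\<And>x. q x = c + g \<bullet> x"
    using s by auto
  note unique = has_derivative_unique_within_convex[OF _ _ convex_ref_elem interior_ref_elem]
  note K = meshD[OF D, unfolded s]
  have T: "(?T has_derivative L) (at y within ?R)" if y: "y \<in> ?R" for y
  proof (rule has_derivative_transform[OF y])
    show "((\<lambda>y. L y + b) has_derivative L) (at y within ?R)"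
      using L(1) by (auto intro!: derivative_eq_intros linear_imp_has_derivative)
  qed (rule L(2))
  have *: "grad w K (?T y) \<bullet> L h = g \<bullet> h" if y: "y \<in> ?R" for y h
  proof -
    have "(w has_derivative (\<lambda>h. grad w K (?T y) \<bullet> h)) (at (?T y) within ?T ` ?R)"
      using H_h_gradient(2)[OF D w, of "?T y"] K(2) y by auto
    then have "((\<lambda>y. w (?T y)) has_derivative (\<lambda>h. grad w K (?T y) \<bullet> L h)) (at y within ?R)"
      by (rule has_derivative_in_compose[OF T[OF y]])
    moreover have "((\<lambda>y. w (?T y)) has_derivative (\<lambda>h. g \<bullet> h)) (at y within ?R)"
      by (rule has_derivative_transform[OF y, where f = "\<lambda>y. c + g \<bullet> y"])
        (auto simp: q cg intro!: derivative_eq_intros)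
    ultimately have "(\<lambda>h. grad w K (?T y) \<bullet> L h) = (\<lambda>h. g \<bullet> h)"
      using y by (rule unique)
    then show ?thesis by metis
  qed
  obtain y y' where y: "y \<in> ?R" "x = ?T y" "y' \<in> ?R" "x' = ?T y'"
    using K(2) x by blast
  obtain T' where T': "(?T has_derivative T') (at y within ?R)" "surj T'"
    using diffeomorphism_derivative[OF K(1) convex_ref_elem interior_ref_elem y(1)] by metis
  \<comment> \<open>By uniqueness \<open>L\<close> is the derivative of the diffeomorphism
    \<open>?T\<close>, which is onto.\<close>
  then have "surj L"
    using unique[OF T'(1) T[OF y(1)] y(1)] by simp
  moreover have "grad w K x \<bullet> L h = grad w K x' \<bullet> L h" for h
    using * y by simp
  ultimately show ?thesis
    by (metis inner_commute surj_f_inv_f vector_eq_rdot)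
qed

text \<open>The vertices of \<open>K\<close> give nodes other than \<open>i\<close>, as they belong
  to another element. The basis function is zero at all of them, hence on \<open>K\<close> by
  unisolvence.\<close>

lemma shape_vanishes:
  assumes D: "mesh D" "nodal_basis D" and s: "setting D = Simplicial"
    and i: "i \<in> nodes D" and K: "K \<in> Th D" "K \<noteq> fst i" and x: "x \<in> K"
  shows "shape D i K x = 0"
proof -
  have "shape D i \<in> V_h D"
    using D i by (simp add: nodal_basis_def)
  then obtain q where q: "q \<in> ref_space Simplicial" "\<forall>y\<in>ref_elem Simplicial. shape D i K (Tmap D K y) = q y"
    using K s unfolding V_h_def by (auto simp del: ref_elem.simps ref_space.simps)
  have "q y = 0" if y: "y \<in> ref_vertices Simplicial" for y
  proof -
    have "(K, Tmap D K y) \<in> nodes D"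
      using y K s by (auto simp: nodes_def)
    then have "at_node (shape D i) (K, Tmap D K y) = 0"
      using D i K by (auto simp: nodal_basis_def)
    then show ?thesis
      using q(2) y ref_vertices_subset[of Simplicial]
      by (auto simp: at_node_def simp del: ref_elem.simps ref_vertices.simps)
  qed
  then have "q y = 0" for y
    using ref_space_Simplicial_zero[OF q(1)] by blast
  then show ?thesis
    using q(2) x meshD(2)[OF D(1) K(1)] s by (metis imageE)
qed

lemma weighted_form_eq_lumped:
  assumes D: "mesh D" "nodal_basis D" and w: "w \<in> H_h D" "v \<in> H_h D"
  shows "weighted_form D rho w v
    = (\<Sum>i\<in>nodes D. mass D i * (rho i * (at_node (grad w) i \<bullet> at_node (grad v) i)))"
proof (cases "setting D")
  case Tensor
  then show ?thesis
    using at_node_fe_fun[OF D, of _ rho] unfolding weighted_form_def lumped_def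
    by (auto intro!: sum.cong simp: at_node_def)
next
  case s: Simplicial
  let ?g = "\<lambda>i. at_node (grad w) i \<bullet> at_node (grad v) i"
  have int: "set_integrable lborel K (shape D i K)" if i: "i \<in> nodes D" and K: "K \<in> Th D" for i K
  proof -
    have "shape D i \<in> V_h D"
      using D i by (simp add: nodal_basis_def)
    then obtain g where "\<And>x. x \<in> K \<Longrightarrow> (shape D i K has_derivative (\<lambda>h. g x \<bullet> h)) (at x within K)"
      using V_h_has_derivative[OF D(1) K] by metis
    then have "continuous_on K (shape D i K)"
      by (rule has_derivative_continuous_on)
    then show ?thesis
      by (rule set_integrable_element[OF D(1) K])
  qed
  \<comment> \<open>On the element of \<open>i\<close> the gradients may be replaced by their values
    at the node, being constant; on every other element both sides vanish.\<close>
  have loc: "shape D i K x * rho i * (grad w K x \<bullet> grad v K x) = shape D i K x * (rho i * ?g i)"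
    if i: "i \<in> nodes D" and K: "K \<in> Th D" and x: "x \<in> K" for i K x
  proof (cases "K = fst i")
    case True
    then show ?thesis
      using grad_const_Simplicial[OF D(1) K s _ x, of _ "snd i"] node_in_element[OF D(1) i] w
      by (simp add: at_node_def)
  next
    case False
    then show ?thesis
      using shape_vanishes[OF D s i K _ x] by simp
  qed
  have "weighted_form D rho w v
    = (\<Sum>K\<in>Th D. LINT x:K|lborel. (\<Sum>i\<in>nodes D. shape D i K x * (rho i * ?g i)))"
    using s unfolding weighted_form_def l2_prod_def integral_Omega_def
    by (auto intro!: sum.cong set_integral_cong_pointwise
        simp: fe_fun_def sum_distrib_right loc)
  also have "\<dots> = (\<Sum>K\<in>Th D. \<Sum>i\<in>nodes D. (LINT x:K|lborel. shape D i K x) * (rho i * ?g i))"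
    using int finite_nodes[OF D(1)] unfolding set_lebesgue_integral_def set_integrable_def
    by (simp add: sum_distrib_left mult.assoc[symmetric] Bochner_Integration.integral_sum)
  \<comment> \<open>Exchanging the sums collects the integrals of each basis function over all
    elements, which is its mass.\<close>
  also have "\<dots> = (\<Sum>i\<in>nodes D. mass D i * (rho i * ?g i))"
    by (subst sum.swap) (simp add: mass_def integral_Omega_def sum_distrib_right)
  finally show ?thesis .
qed

section \<open>Energy balance of the source update and of the full step\<close>

lemma kinetic_energy_increment:
  fixes V V' g f :: "'a::real_inner"
  assumes rho: "rho > 0" and V': "rho *\<^sub>R V' = rho *\<^sub>R V - (tau / 2 * rho) *\<^sub>R g + (tau / 2) *\<^sub>R f"
  shows "rho / 2 * ((norm V')\<^sup>2 - (norm V)\<^sup>2)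
    = tau / 4 * (f \<bullet> (V + V')) - tau / 2 * (rho * (V \<bullet> g)) + tau\<^sup>2 / 8 * (rho * (g \<bullet> g)) - tau\<^sup>2 / 8 * (f \<bullet> g)"
proof -
  define d where "d = (tau / 2) *\<^sub>R (f - rho *\<^sub>R g)"
  have d: "rho *\<^sub>R V' = rho *\<^sub>R V + d"
    unfolding V' d_def by (simp add: algebra_simps)
  then have diff: "rho *\<^sub>R V' - rho *\<^sub>R V = d"
    by simp
  have "rho / 2 * ((norm V')\<^sup>2 - (norm V)\<^sup>2) = (1/2) * ((rho *\<^sub>R V' - rho *\<^sub>R V) \<bullet> (V + V'))"
    by (simp add: power2_norm_eq_inner algebra_simps inner_commute)
  also have "\<dots> = tau / 4 * (f \<bullet> (V + V')) - tau / 4 * (g \<bullet> (rho *\<^sub>R V + rho *\<^sub>R V'))"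
    unfolding diff by (simp add: d_def algebra_simps)
  \<comment> \<open>In the pairing with \<open>g\<close> the new velocity is eliminated, because the
    potential equation contains only the old one. The force term keeps \<open>V + V'\<close>, as in
    the claimed balance.\<close>
  also have "g \<bullet> (rho *\<^sub>R V + rho *\<^sub>R V') = 2 * (rho * (V \<bullet> g)) + tau / 2 * (f \<bullet> g) - tau / 2 * (rho * (g \<bullet> g))"
    unfolding d by (simp add: d_def algebra_simps inner_commute)
  finally show ?thesis
    by (simp add: algebra_simps power2_eq_square)
qed

lemma source_update_energy:
  fixes D :: "'d::finite discretization"
  assumes D: "mesh D" "nodal_basis D" and alpha: "alpha \<noteq> 0" and w: "w \<in> H_h D"
    and dens: "\<And>i. i \<in> nodes D \<Longrightarrow> dens u i > 0"
    and upd: "source_update D alpha f0 f1 tau (u, w) (u', w')"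
  shows "(\<Sum>i\<in>nodes D. mass D i * ener u' i) + 1 / (2 * alpha) * (l2_norm D (grad w'))\<^sup>2
    = (\<Sum>i\<in>nodes D. mass D i * ener u i) + 1 / (2 * alpha) * (l2_norm D (grad w))\<^sup>2
      + (\<Sum>i\<in>nodes D. mass D i * (tau / 4 *
           ((at_node f1 i + at_node f0 i) \<bullet> (velocity u i + velocity u' i))))"
proof -
  define v where "v = (\<lambda>x. w' x + w x)"
  define f where "f i = at_node f1 i + at_node f0 i" for i
  define g where "g i = at_node (grad v) i" for i
  obtain V' where V': "\<And>i. i \<in> nodes D \<Longrightarrow>
        dens u i *\<^sub>R V' i =
          dens u i *\<^sub>R velocity u i
          - (tau / 2 * dens u i) *\<^sub>R (at_node (grad w') i + at_node (grad w) i)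
          + (tau / 2) *\<^sub>R f i \<and>
        dens u' i = dens u i \<and>
        mom u' i = dens u i *\<^sub>R V' i \<and>
        ener u' i = ener u i + 1 / (2 * dens u' i) * ((norm (mom u' i))\<^sup>2 - (norm (mom u i))\<^sup>2)"
    using upd unfolding source_update_def f_def by auto
  have w': "w' \<in> H_h D"
    using upd by (simp add: source_update_def)
  then have v: "v \<in> H_h D"
    using H_h_add w by (simp add: v_def)
  have g: "g i = at_node (grad w') i + at_node (grad w) i" if "i \<in> nodes D" for i
    using grad_add[OF D(1) _ w' w] node_in_element[OF D(1) that] by (simp add: g_def v_def at_node_def)
  \<comment> \<open>\<open>P\<close>, \<open>Q\<close> and \<open>F\<close> enter the potential and
    the kinetic increment with opposite signs; \<open>B\<close>, the work of the external force, is
    what remains.\<close>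
  define P where "P = (\<Sum>i\<in>nodes D. mass D i * (dens u i * (velocity u i \<bullet> g i)))"
  define Q where "Q = (\<Sum>i\<in>nodes D. mass D i * (dens u i * (g i \<bullet> g i)))"
  define F where "F = (\<Sum>i\<in>nodes D. mass D i * (f i \<bullet> g i))"
  define B where "B = (\<Sum>i\<in>nodes D. mass D i * (tau / 4 * (f i \<bullet> (velocity u i + velocity u' i))))"
  have "a_plus D alpha tau (dens u) w' v = a_minus D alpha tau (dens u) w v
      + tau * alpha * lumped D (\<lambda>K x. fe_fun D (dens u) K x *\<^sub>R fe_fun D (velocity u) K x) (grad v)
      + tau\<^sup>2 * alpha / 4 * lumped D (\<lambda>K x. f1 K x + f0 K x) (grad v)"
    using upd v by (simp add: source_update_def)
  moreover have "lumped D (\<lambda>K x. fe_fun D (dens u) K x *\<^sub>R fe_fun D (velocity u) K x) (grad v) = P"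
    using at_node_fe_fun[OF D, of _ "dens u"] at_node_fe_fun[OF D, of _ "velocity u"]
    by (auto simp: lumped_def P_def at_node_def g_def intro!: sum.cong)
  moreover have "lumped D (\<lambda>K x. f1 K x + f0 K x) (grad v) = F"
    by (simp add: lumped_def F_def f_def g_def at_node_def)
  \<comment> \<open>When \<open>a_minus\<close> is moved to the left, the weighted forms add up,
    whereas the gradient products are subtracted.\<close>
  moreover have "weighted_form D (dens u) w' v + weighted_form D (dens u) w v = Q"
    unfolding weighted_form_eq_lumped[OF D w' v] weighted_form_eq_lumped[OF D w v] Q_def
      sum.distrib[symmetric]
    by (intro sum.cong refl) (simp add: g g_def[symmetric] inner_add_left inner_add_right algebra_simps)
  moreover have "l2_prod D (grad w') (grad v) - l2_prod D (grad w) (grad v)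
      = (l2_norm D (grad w'))\<^sup>2 - (l2_norm D (grad w))\<^sup>2"
    unfolding v_def l2_norm_power2 by (rule l2_prod_grad_sum_diff[OF D(1) w' w])
  ultimately have "(l2_norm D (grad w'))\<^sup>2 - (l2_norm D (grad w))\<^sup>2
      = alpha * (tau * P + tau\<^sup>2 / 4 * F - tau\<^sup>2 / 4 * Q)"
    unfolding a_plus_def a_minus_def by algebra
  \<comment> \<open>Dividing by \<open>2 * alpha\<close> produces the coefficients
    \<open>tau / 2\<close> and \<open>tau\<^sup>2 / 8\<close> of the kinetic increment.\<close>
  then have pot: "1 / (2 * alpha) * (l2_norm D (grad w'))\<^sup>2
      = 1 / (2 * alpha) * (l2_norm D (grad w))\<^sup>2 + (tau / 2 * P + tau\<^sup>2 / 8 * F - tau\<^sup>2 / 8 * Q)"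
    using alpha by (simp add: field_simps)
  have ener: "ener u' i = ener u i + (tau / 4 * (f i \<bullet> (velocity u i + velocity u' i))
      - tau / 2 * (dens u i * (velocity u i \<bullet> g i)) + tau\<^sup>2 / 8 * (dens u i * (g i \<bullet> g i))
      - tau\<^sup>2 / 8 * (f i \<bullet> g i))" if i: "i \<in> nodes D" for i
  proof -
    have rho: "dens u i > 0"
      using dens i by blast
    have mom: "mom u i = dens u i *\<^sub>R velocity u i"
      using rho by (simp add: velocity_def)
    have vel: "velocity u' i = V' i"
      using V'[OF i] rho unfolding velocity_def
      by (metis left_inverse less_irrefl scaleR_one scaleR_scaleR)
    have "ener u' i = ener u i + dens u i / 2 * ((norm (V' i))\<^sup>2 - (norm (velocity u i))\<^sup>2)"
      using V'[OF i] rho by (simp add: mom power_mult_distrib field_simps power2_eq_square)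
    moreover have "dens u i *\<^sub>R V' i =
        dens u i *\<^sub>R velocity u i - (tau / 2 * dens u i) *\<^sub>R g i + (tau / 2) *\<^sub>R f i"
      using V'[OF i] unfolding g[OF i] by blast
    ultimately show ?thesis
      using kinetic_energy_increment[OF rho] unfolding vel by metis
  qed
  have "(\<Sum>i\<in>nodes D. mass D i * ener u' i)
      = (\<Sum>i\<in>nodes D. mass D i * ener u i) + (B - tau / 2 * P + tau\<^sup>2 / 8 * Q - tau\<^sup>2 / 8 * F)"
    unfolding B_def P_def Q_def F_def sum_distrib_left sum.distrib[symmetric] sum_subtractf[symmetric]
    by (intro sum.cong refl) (simp add: ener algebra_simps)
  then show ?thesis
    using pot by (simp add: B_def f_def)
qed

theorem lemma3p9:
  fixes D :: "'d::finite discretization"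
    and hyp :: "'d hyperbolic"
    and alpha tau :: real
    and f0 f1 :: "('d, real^'d) broken"
    and u0 u1 u2 u' :: "'d euler"
    and phi0 phi1 phi2 phi' :: "real^'d \<Rightarrow> real"
  assumes "alpha \<noteq> 0"
    and "mesh D" and "nodal_basis D" and "periodic_domain D"
    and "elementwise_continuous D f0" and "elementwise_continuous D f1"
    and "positivity_preserving D hyp" and "energy_conserving D hyp"
    and "phi0 \<in> H_h D"
    and "\<forall>i\<in>nodes D. dens u0 i > 0 \<and> ener u0 i - (norm (mom u0 i))\<^sup>2 / (2 * dens u0 i) > 0"
    and "tau > 0"
    and "yanenko_step D hyp alpha \<infinity> f0 f1 tau (u0, phi0) (u1, phi1) (u2, phi2) (u', phi')"
  shows "(\<forall>i\<in>nodes D. dens u' i > 0 \<and> ener u' i - (norm (mom u' i))\<^sup>2 / (2 * dens u' i) > 0) \<and>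
    (\<Sum>i\<in>nodes D. mass D i * ener u' i) + 1 / (2 * alpha) * (l2_norm D (grad phi'))\<^sup>2
      \<le> (\<Sum>i\<in>nodes D. mass D i * ener u0 i) + 1 / (2 * alpha) * (l2_norm D (grad phi0))\<^sup>2
        + (\<Sum>i\<in>nodes D. mass D i * (tau / 4 *
             ((at_node f1 i + at_node f0 i) \<bullet> (velocity u1 i + velocity u2 i))))"
proof -
  \<comment> \<open>For infinite relaxation time the damping factor is 1 and the energy correction
    is zero, so relaxation is the identity at the nodes.\<close>
  have hyp: "hyp u0 = (tau, u1)" and phi: "phi1 = phi0" "phi' = phi2"
    and src: "source_update D alpha f0 f1 tau (u1, phi0) (u2, phi2)"
    and relax: "\<And>i. i \<in> nodes D \<Longrightarrow> dens u' i = dens u2 i \<and> mom u' i = mom u2 i \<and> ener u' i = ener u2 i"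
    using assms(12) by (auto simp: yanenko_step_def relaxation_update_def damping_def)
  have adm: "dens u1 i > 0" "ener u1 i - (norm (mom u1 i))\<^sup>2 / (2 * dens u1 i) > 0" if "i \<in> nodes D" for i
    using assms(7,10) hyp that unfolding positivity_preserving_def admissible_def by (metis snd_conv)+
  \<comment> \<open>The total energy changes exactly by the kinetic energy at unchanged density, so
    the internal energy carries over from \<open>u1\<close>.\<close>
  have pos: "dens u2 i > 0 \<and> ener u2 i - (norm (mom u2 i))\<^sup>2 / (2 * dens u2 i) > 0" if i: "i \<in> nodes D" for i
  proof -
    have "dens u2 i = dens u1 i"
      "ener u2 i = ener u1 i + 1 / (2 * dens u2 i) * ((norm (mom u2 i))\<^sup>2 - (norm (mom u1 i))\<^sup>2)"
      using src i by (auto simp: source_update_def)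
    then show ?thesis
      using adm[OF i] by (simp add: diff_divide_distrib)
  qed
  have "(\<Sum>i\<in>nodes D. mass D i * ener u1 i) = (\<Sum>i\<in>nodes D. mass D i * ener u0 i)"
    using assms(8) hyp unfolding energy_conserving_def by (metis snd_conv)
  then have "(\<Sum>i\<in>nodes D. mass D i * ener u2 i) + 1 / (2 * alpha) * (l2_norm D (grad phi2))\<^sup>2
      = (\<Sum>i\<in>nodes D. mass D i * ener u0 i) + 1 / (2 * alpha) * (l2_norm D (grad phi0))\<^sup>2
        + (\<Sum>i\<in>nodes D. mass D i * (tau / 4 *
             ((at_node f1 i + at_node f0 i) \<bullet> (velocity u1 i + velocity u2 i))))"
    using source_update_energy[OF assms(2,3,1,9) adm(1) src] by simp
  then show ?thesis
    using pos relax phi(2) by simp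
qed

end
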